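(* Let $\epsilon\in(0,1)$, let $\|\cdot\|$ be a user-specified norm on $\mathbb{R}^d$, and let $D_{\mathrm{cal}}=\{\tilde{\mathbf Y}^{(i)}_{0:T-1}\}_{i=1}^N$ be an exchangeable calibration dataset of residual sequences. The region $\Gamma^\epsilon:\hat{\mathbf Y}_{0:T-1}\mapsto\bigotimes_{t=0}^{T-1}\mathcal{C}_t$ produced by Optimal Selection Conformal Prediction (OSCP, the procedure described in the context) is valid, satisfying trajectory-level coverage: for a new trajectory $\mathbf Y^{(\mathrm{new})}_{0:T-1}$, $$\mathbb{P}\left(Y^{(\mathrm{new})}_t\in\mathcal{C}_t,\ \forall t=0,\dots,T-1\right)\ \ge\ 1-\epsilon,$$ where $\mathbb{P}$ is the joint probability measure of $D_{\mathrm{cal},2}$ and the new residual sequence $\tilde{\mathbf Y}^{(\mathrm{new})}_{0:T-1}$.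
   Context: Setting. A true trajectory $\mathbf Y_{0:T-1}=(Y_0,\dots,Y_{T-1})\in\mathbb{R}^{d\times T}$ has a nominal (predicted) trajectory $\hat{\mathbf Y}_{0:T-1}=(\hat Y_0,\dots,\hat Y_{T-1})\in\mathbb{R}^{d\times T}$. Its residual sequence is $\tilde{\mathbf Y}_{0:T-1}=(\tilde Y_0,\dots,\tilde Y_{T-1})$ with $\tilde Y_t=Y_t-\hat Y_t$. The residual sequence is a random quantity distributed according to a probability measure, and all data are assumed to come from the same distribution. If the nominal trajectories come from a data-driven model, the calibration dataset contains no residuals of that model's training data. The calibration dataset $D_{\mathrm{cal}}$ contains the residual sequences of $N$ historical trajectories. A collection of $N$ random variables is exchangeable if the joint probability distribution of any permutation of them is the same. Exchangeability is assumed only at the level of whole $T$-horizon trajectories, so $\tilde Y_t$ and $\tilde Y_{t'}$ with $t\ne t'$ may be correlated. A set-valued predictor $\Gamma^\epsilon$ is called valid if, for any new trajectory, $\mathbb{P}(\mathbf Y^{(\mathrm{new})}_{0:T-1}\in\Gamma^\epsilon(\hat{\mathbf Y}^{(\mathrm{new})}_{0:T-1}))\ge 1-\epsilon$. For a residual sequence $\tilde{\mathbf Y}^{(i)}_{0:T-1}$ put $\tilde e^{(i)}_t=\|\tilde Y^{(i)}_t\|$, $t=0,\dots,T-1$. OSCP procedure. (1) Randomly split $D_{\mathrm{cal}}$ into two disjoint subsets $D_{\mathrm{cal},1}$, $D_{\mathrm{cal},2}$ of sizes $n_1,n_2$. It is assumed that $\epsilon\ge 1/(n_j+1)$ for $j=1,2$,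 so that $p_j=\lceil(1-\epsilon)(n_j+1)\rceil\in\{1,\dots,n_j\}$. (2) Using only $D_{\mathrm{cal},1}$ (its elements indexed by $i=1,\dots,n_1$), let $r_0^*,\dots,r_{T-1}^*$ be optimal values of $r_0,\dots,r_{T-1}$ in the mixed-integer linear program: minimize $\sum_{t=0}^{T-1}r_t$ over $r_0,\dots,r_{T-1}$ and $b_1,\dots,b_{n_1}$ subject to $r_t\ge\tilde e^{(i)}_t b_i$ for all $t=0,\dots,T-1$ and $i=1,\dots,n_1$, $\sum_{i=1}^{n_1}b_i=p_1$, and $b_i\in\{0,1\}$ for all $i$. The score function is $\mathcal{A}(\tilde{\mathbf Y}^{(i)}_{0:T-1})=\max\{\tilde e^{(i)}_0-r_0^*,\dots,\tilde e^{(i)}_{T-1}-r_{T-1}^*\}$. (3) Compute the scores $R_i=\mathcal{A}(\tilde{\mathbf Y}^{(i)}_{0:T-1})$ for each element of $D_{\mathrm{cal},2}$. (4) Let $R^{[p_2]}$ be the $p_2$-th smallest score from $D_{\mathrm{cal},2}$. Output $\Gamma^\epsilon:\hat{\mathbf Y}_{0:T-1}\mapsto\bigotimes_{t=0}^{T-1}\mathcal{C}_t$ with $\mathcal{C}_t=\{y\in\mathbb{R}^d:\|y-\hat Y_t\|\le R^{[p_2]}+r_t^*\}$; for the new trajectory, $\hat Y_t=\hat Y_t^{(\mathrm{new})}$.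
   Formalization: The new residual sequence is assumed to be jointly exchangeable with the N calibration residual sequences; exchangeability of the calibration dataset alone with equal distributions does not suffice for the coverage bound. *)

theory Defs
  imports "HOL-Probability.Probability"
begin

text \<open>A norm in the analyst's sense, chosen by the user and unrelated to the
  type-class norm of the underlying vector space.\<close>

definition is_norm :: "('v::real_vector \<Rightarrow> real) \<Rightarrow> bool" where
  "is_norm nrm \<longleftrightarrow>
     (\<forall>x. nrm x \<ge> 0) \<and> (\<forall>x. nrm x = 0 \<longleftrightarrow> x = 0) \<and>
     (\<forall>c x. nrm (c *\<^sub>R x) = \<bar>c\<bar> * nrm x) \<and>
     (\<forall>x y. nrm (x + y) \<le> nrm x + nrm y)"

definition exchangeable :: "'w measure \<Rightarrow> 'a measure \<Rightarrow> nat set \<Rightarrow> (nat \<Rightarrow> 'w \<Rightarrow> 'a) \<Rightarrow> bool" where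
  "exchangeable M S I X \<longleftrightarrow>
     (\<forall>i\<in>I. X i \<in> M \<rightarrow>\<^sub>M S) \<and>
     (\<forall>\<pi>. \<pi> permutes I \<longrightarrow>
        distr M (PiM I (\<lambda>_. S)) (\<lambda>\<omega>. \<lambda>i\<in>I. X (\<pi> i) \<omega>)
      = distr M (PiM I (\<lambda>_. S)) (\<lambda>\<omega>. \<lambda>i\<in>I. X i \<omega>))"

text \<open>A trajectory with horizon \<open>T\<close> is a function on time of which only the values at
  \<open>0, \<dots>, T - 1\<close> matter. Residual sequences are restricted to \<open>{..<T}\<close>, so that
  they are points of the product space below.\<close>

type_synonym 'v trajectory = "nat \<Rightarrow> 'v"

definition trajectory_space :: "nat \<Rightarrow> ('v::topological_space) trajectory measure" where
  "trajectory_space T = PiM {..<T} (\<lambda>_. borel)"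

definition residual :: "nat \<Rightarrow> ('v::real_vector) trajectory \<Rightarrow> 'v trajectory \<Rightarrow> 'v trajectory" where
  "residual T y yhat = (\<lambda>t\<in>{..<T}. y t - yhat t)"

text \<open>A dataset of size \<open>n\<close> is a function on \<open>{1..n}\<close>.\<close>

abbreviation dataset_space :: "nat \<Rightarrow> nat \<Rightarrow> (nat \<Rightarrow> ('v::topological_space) trajectory) measure" where
  "dataset_space T n \<equiv> PiM {1..n} (\<lambda>_. trajectory_space T)"

definition conformal_rank :: "real \<Rightarrow> nat \<Rightarrow> nat" where
  "conformal_rank \<epsilon> n = nat \<lceil>(1 - \<epsilon>) * (real n + 1)\<rceil>"

definition milp_feasible ::
  "nat \<Rightarrow> nat \<Rightarrow> nat \<Rightarrow> (nat \<Rightarrow> nat \<Rightarrow> real) \<Rightarrow> (nat \<Rightarrow> real) \<Rightarrow> (nat \<Rightarrow> real) \<Rightarrow> bool" where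
  "milp_feasible T n p e r b \<longleftrightarrow>
     (\<forall>t<T. \<forall>i\<in>{1..n}. r t \<ge> e i t * b i) \<and>
     (\<Sum>i=1..n. b i) = real p \<and>
     (\<forall>i\<in>{1..n}. b i \<in> {0, 1})"

definition milp_optimal_radii ::
  "nat \<Rightarrow> nat \<Rightarrow> nat \<Rightarrow> (nat \<Rightarrow> nat \<Rightarrow> real) \<Rightarrow> (nat \<Rightarrow> real) \<Rightarrow> bool" where
  "milp_optimal_radii T n p e r \<longleftrightarrow>
     (\<exists>b. milp_feasible T n p e r b \<and>
        (\<forall>r' b'. milp_feasible T n p e r' b' \<longrightarrow> (\<Sum>t<T. r t) \<le> (\<Sum>t<T. r' t)))"

definition score :: "nat \<Rightarrow> ('v \<Rightarrow> real) \<Rightarrow> (nat \<Rightarrow> real) \<Rightarrow> 'v trajectory \<Rightarrow> real" where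
  "score T nrm r z = Max ((\<lambda>t. nrm (z t) - r t) ` {..<T})"

definition kth_smallest :: "nat \<Rightarrow> nat \<Rightarrow> (nat \<Rightarrow> real) \<Rightarrow> real" where
  "kth_smallest k n R = sort (map R [1..<Suc n]) ! (k - 1)"

text \<open>\<open>r\<close> are the radii obtained from the first part of the calibration data, \<open>D2\<close> is the
  second part, of size \<open>n2\<close>.\<close>

definition oscp_tube ::
  "nat \<Rightarrow> ('v::real_vector \<Rightarrow> real) \<Rightarrow> real \<Rightarrow> nat \<Rightarrow> (nat \<Rightarrow> real) \<Rightarrow> (nat \<Rightarrow> 'v trajectory)
    \<Rightarrow> 'v trajectory \<Rightarrow> nat \<Rightarrow> 'v set" where
  "oscp_tube T nrm \<epsilon> n2 r D2 yhat t =
     {y. nrm (y - yhat t)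
         \<le> kth_smallest (conformal_rank \<epsilon> n2) n2 (\<lambda>i. score T nrm r (D2 i)) + r t}"

definition oscp_region ::
  "nat \<Rightarrow> ('v::real_vector \<Rightarrow> real) \<Rightarrow> real \<Rightarrow> nat \<Rightarrow> (nat \<Rightarrow> real) \<Rightarrow> (nat \<Rightarrow> 'v trajectory)
    \<Rightarrow> 'v trajectory \<Rightarrow> 'v trajectory set" where
  "oscp_region T nrm \<epsilon> n2 r D2 yhat = Pi {..<T} (oscp_tube T nrm \<epsilon> n2 r D2 yhat)"

end

theory Submission
  imports Defs
begin

text \<open>Relabelling the trajectories by the random ordering, which is independent of the data
  and leaves the new trajectory in place, keeps them exchangeable, so the random split may be
  treated as the deterministic split of an exchangeable sequence. The new trajectory
  lies in the region iff fewer than \<open>p\<^sub>2\<close> of the scores in \<open>D2\<close> are smaller than its own. Among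
  the \<open>n\<^sub>2 + 1\<close> trajectories outside \<open>D1\<close> always at least \<open>p\<^sub>2\<close> have this property, and by
  exchangeability each of them has it with the same probability on every event determined by
  \<open>D1\<close>. Hence the coverage given \<open>D1\<close> is at least \<open>p\<^sub>2 / (n\<^sub>2 + 1) \<ge> 1 - \<epsilon>\<close>.\<close>

section \<open>Ranks\<close>

text \<open>After sorting, the entries strictly below \<open>x\<close> form an initial segment, and
  \<open>x\<close> is at most the \<open>k\<close>-th entry exactly when this segment stops before
  it. The strict comparison makes ties harmless.\<close>

lemma le_kth_smallest_iff:
  assumes "1 \<le> k" "k \<le> n"
  shows "x \<le> kth_smallest k n R \<longleftrightarrow> card {i \<in> {1..n}. R i < x} < k"
proof -
  define xs where "xs = sort (map R [1..<Suc n])"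
  have len: "length xs = n" and srt: "sorted xs"
    by (auto simp: xs_def)
  have "card {i \<in> {1..n}. R i < x} = length (filter (\<lambda>i. R i < x) [1..<Suc n])"
    by (subst distinct_card[symmetric]) (auto intro!: arg_cong[where f = card])
  also have "\<dots> = length (filter (\<lambda>y. y < x) (map R [1..<Suc n]))"
    by (simp add: filter_map o_def del: upt_Suc)
  also have "\<dots> = length (filter (\<lambda>y. y < x) xs)"
    unfolding xs_def by (metis mset_filter mset_sort size_mset)
  also have "\<dots> = card {i. i < n \<and> xs ! i < x}"
    by (simp add: length_filter_conv_card len)
  finally have card_eq: "card {i \<in> {1..n}. R i < x} = card {i. i < n \<and> xs ! i < x}" .
  have "x \<le> xs ! (k - 1) \<longleftrightarrow> card {i. i < n \<and> xs ! i < x} < k"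
  proof
    assume x: "x \<le> xs ! (k - 1)"
    \<comment> \<open>List positions start at 0, so the \<open>k\<close>-th smallest entry sits at
      \<open>k - 1\<close>; an entry below \<open>x\<close> cannot stand at or after it.\<close>
    have "{i. i < n \<and> xs ! i < x} \<subseteq> {..<k - 1}"
    proof safe
      fix i assume i: "i < n" "xs ! i < x"
      show "i < k - 1"
      proof (rule ccontr)
        assume "\<not> i < k - 1"
        then have "xs ! (k - 1) \<le> xs ! i"
          using sorted_nth_mono[OF srt, of "k - 1" i] i len by simp
        with i x show False by simp
      qed
    qed
    from card_mono[OF _ this] show "card {i. i < n \<and> xs ! i < x} < k"
      using assms by simp
  next
    assume less: "card {i. i < n \<and> xs ! i < x} < k"
    show "x \<le> xs ! (k - 1)"
    proof (rule ccontr)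
      assume "\<not> x \<le> xs ! (k - 1)"
      then have "xs ! i < x" if "i < k" for i
        using sorted_nth_mono[OF srt, of i "k - 1"] that assms len by fastforce
      then have "{..<k} \<subseteq> {i. i < n \<and> xs ! i < x}"
        using assms by auto
      from card_mono[OF _ this] less show False by simp
    qed
  qed
  then show ?thesis
    unfolding kth_smallest_def xs_def[symmetric] card_eq .
qed

text \<open>Were there fewer than \<open>p\<close> such elements, take a minimiser \<open>j\<close>
  of \<open>f\<close> among the others. Everything strictly below \<open>j\<close> is then of small
  rank, hence fewer than \<open>p\<close> elements are, so \<open>j\<close> has small rank itself, a
  contradiction.\<close>

lemma card_small_rank_ge:
  fixes f :: "'a \<Rightarrow> 'b::linorder"
  assumes "finite J" "p \<le> card J"
  shows "p \<le> card {j \<in> J. card {i \<in> J. f i < f j} < p}"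
proof (rule ccontr)
  let ?S = "{j \<in> J. card {i \<in> J. f i < f j} < p}"
  assume less: "\<not> p \<le> card ?S"
  then have "J - ?S \<noteq> {}"
    using assms card_mono[of ?S J] by auto
  then obtain j where j: "j \<in> J - ?S" and min: "\<And>i. i \<in> J - ?S \<Longrightarrow> f j \<le> f i"
    using ex_min_if_finite[of "f ` (J - ?S)"] assms(1)
    by (metis (no_types, lifting) arg_min_if_finite(1) arg_min_least finite_Diff)
  have "{i \<in> J. f i < f j} \<subseteq> ?S"
    using min by force
  then have "card {i \<in> J. f i < f j} \<le> card ?S"
    using assms(1) by (intro card_mono) auto
  with j less show False by auto
qed

section \<open>Exchangeable families\<close>

lemma exchangeable_measurable:
  "exchangeable M S I X \<Longrightarrow> i \<in> I \<Longrightarrow> X i \<in> M \<rightarrow>\<^sub>M S"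
  by (simp add: exchangeable_def)

lemma exchangeable_permute:
  assumes X: "exchangeable M S I X" and \<pi>: "\<pi> permutes I" and B: "B \<in> sets (PiM I (\<lambda>_. S))"
  shows "measure M {\<omega> \<in> space M. (\<lambda>i\<in>I. X (\<pi> i) \<omega>) \<in> B}
       = measure M {\<omega> \<in> space M. (\<lambda>i\<in>I. X i \<omega>) \<in> B}"
proof -
  have meas: "(\<lambda>\<omega>. \<lambda>i\<in>I. X (\<rho> i) \<omega>) \<in> M \<rightarrow>\<^sub>M PiM I (\<lambda>_. S)" if "\<rho> permutes I" for \<rho>
    using X that by (intro measurable_restrict exchangeable_measurable) (auto simp: permutes_in_image)
  have distr: "measure (distr M (PiM I (\<lambda>_. S)) (\<lambda>\<omega>. \<lambda>i\<in>I. X (\<rho> i) \<omega>)) B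
      = measure M {\<omega> \<in> space M. (\<lambda>i\<in>I. X (\<rho> i) \<omega>) \<in> B}" if "\<rho> permutes I" for \<rho>
    using measure_distr[OF meas[OF that] B]
    by (simp add: vimage_def Int_def conj_commute)
  show ?thesis
    using X \<pi> distr[of \<pi>] distr[of id] by (simp add: exchangeable_def permutes_id)
qed

lemma exchangeableI:
  assumes "prob_space M" and X: "\<And>i. i \<in> I \<Longrightarrow> X i \<in> M \<rightarrow>\<^sub>M S"
    and eq: "\<And>\<pi> B. \<pi> permutes I \<Longrightarrow> B \<in> sets (PiM I (\<lambda>_. S)) \<Longrightarrow>
      measure M {\<omega> \<in> space M. (\<lambda>i\<in>I. X (\<pi> i) \<omega>) \<in> B}
      = measure M {\<omega> \<in> space M. (\<lambda>i\<in>I. X i \<omega>) \<in> B}"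
  shows "exchangeable M S I X"
proof -
  interpret prob_space M by fact
  have meas: "(\<lambda>\<omega>. \<lambda>i\<in>I. X (\<rho> i) \<omega>) \<in> M \<rightarrow>\<^sub>M PiM I (\<lambda>_. S)" if "\<rho> permutes I" for \<rho>
    using that by (intro measurable_restrict X) (auto simp: permutes_in_image)
  have distr: "emeasure (distr M (PiM I (\<lambda>_. S)) (\<lambda>\<omega>. \<lambda>i\<in>I. X (\<rho> i) \<omega>)) B
      = measure M {\<omega> \<in> space M. (\<lambda>i\<in>I. X (\<rho> i) \<omega>) \<in> B}"
    if "\<rho> permutes I" "B \<in> sets (PiM I (\<lambda>_. S))" for \<rho> B
    using emeasure_distr[OF meas[OF that(1)] that(2)]
    by (simp add: emeasure_eq_measure vimage_def Int_def conj_commute)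
  have "distr M (PiM I (\<lambda>_. S)) (\<lambda>\<omega>. \<lambda>i\<in>I. X (\<pi> i) \<omega>)
      = distr M (PiM I (\<lambda>_. S)) (\<lambda>\<omega>. \<lambda>i\<in>I. X i \<omega>)" if "\<pi> permutes I" for \<pi>
    using that distr[of \<pi>] distr[of id] eq by (intro measure_eqI) (auto simp: permutes_id)
  then show ?thesis
    using X by (simp add: exchangeable_def)
qed

text \<open>Conditioning on each of the finitely many values of \<open>\<sigma>\<close> leaves a
  deterministic permutation. Independence splits off the probability of that value, the other factor
  does not depend on the value by exchangeability, and the split-off probabilities sum to 1.\<close>

lemma exchangeable_random_relabelling:
  fixes \<sigma> :: "'w \<Rightarrow> nat \<Rightarrow> nat"
  assumes "prob_space M" and X: "exchangeable M S I X" and "finite J" "J \<subseteq> I"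
    and \<sigma>: "\<sigma> \<in> M \<rightarrow>\<^sub>M count_space {\<pi>. \<pi> permutes J}"
    and indep: "prob_space.indep_set M
           (sets (vimage_algebra (space M) \<sigma> (count_space {\<pi>. \<pi> permutes J})))
           (sets (vimage_algebra (space M) (\<lambda>\<omega>. \<lambda>i\<in>I. X i \<omega>) (PiM I (\<lambda>_. S))))"
  shows "exchangeable M S I (\<lambda>i \<omega>. X (\<sigma> \<omega> i) \<omega>)"
proof -
  interpret prob_space M by fact
  let ?P = "PiM I (\<lambda>_. S)" and ?\<Pi> = "{\<pi>. \<pi> permutes J}"
  have fin: "finite ?\<Pi>"
    using \<open>finite J\<close> by (rule finite_permutations)
  have \<Pi>I: "\<rho> permutes I" if "\<rho> \<in> ?\<Pi>" for \<rho>
    using that \<open>J \<subseteq> I\<close> by (auto intro: permutes_subset)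
  have \<sigma>\<Pi>: "\<sigma> \<omega> \<in> ?\<Pi>" if "\<omega> \<in> space M" for \<omega>
    using measurable_space[OF \<sigma> that] by simp
  have X': "X i \<in> M \<rightarrow>\<^sub>M S" if "i \<in> I" for i
    using X that by (rule exchangeable_measurable)
  have meas: "(\<lambda>\<omega>. \<lambda>i\<in>I. X (\<rho> i) \<omega>) \<in> M \<rightarrow>\<^sub>M ?P" if "\<rho> permutes I" for \<rho>
    using that by (intro measurable_restrict X') (auto simp: permutes_in_image)
  have \<sigma>set: "{\<omega> \<in> space M. \<sigma> \<omega> = \<rho>} \<in> sets M" if "\<rho> \<in> ?\<Pi>" for \<rho>
    using measurable_sets[OF \<sigma>, of "{\<rho>}"] that
    by (simp add: vimage_def Int_def conj_commute)
  \<comment> \<open>The index is itself random, so preimages are cut along the values of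
    \<open>\<sigma>\<close>; on each piece a fixed member of the family remains.\<close>
  have X\<sigma>: "(\<lambda>\<omega>. X (\<sigma> \<omega> i) \<omega>) \<in> M \<rightarrow>\<^sub>M S" if "i \<in> I" for i
  proof (rule measurableI)
    fix \<omega> assume "\<omega> \<in> space M"
    then show "X (\<sigma> \<omega> i) \<omega> \<in> space S"
      using \<Pi>I[OF \<sigma>\<Pi>] X' that by (metis measurable_space permutes_in_image)
  next
    fix A assume A: "A \<in> sets S"
    have "(\<lambda>\<omega>. X (\<sigma> \<omega> i) \<omega>) -` A \<inter> space M
        = (\<Union>\<rho>\<in>?\<Pi>. {\<omega> \<in> space M. \<sigma> \<omega> = \<rho>} \<inter> (X (\<rho> i) -` A \<inter> space M))"
      using \<sigma>\<Pi> by auto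
    also have "\<dots> \<in> sets M"
      using fin \<sigma>set A that \<Pi>I
      by (intro sets.finite_UN sets.Int measurable_sets[OF X'])
        (auto simp: permutes_in_image)
    finally show "(\<lambda>\<omega>. X (\<sigma> \<omega> i) \<omega>) -` A \<inter> space M \<in> sets M" .
  qed
  \<comment> \<open>Every permutation of the relabelled family has the law of \<open>X\<close>
    itself. Using this for \<open>\<pi>\<close> and for the identity gives exchangeability.\<close>
  have law: "measure M {\<omega> \<in> space M. (\<lambda>i\<in>I. X (\<sigma> \<omega> (\<pi> i)) \<omega>) \<in> B}
      = measure M {\<omega> \<in> space M. (\<lambda>i\<in>I. X i \<omega>) \<in> B}"
    if \<pi>: "\<pi> permutes I" and B: "B \<in> sets ?P" for \<pi> B
  proof -
    define E where "E \<rho> = {\<omega> \<in> space M. \<sigma> \<omega> = \<rho>}" for \<rho>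
    define C where "C \<rho> = {\<omega> \<in> space M. (\<lambda>i\<in>I. X (\<rho> (\<pi> i)) \<omega>) \<in> B}" for \<rho>
    have \<rho>\<pi>: "(\<lambda>i. \<rho> (\<pi> i)) permutes I" if "\<rho> \<in> ?\<Pi>" for \<rho>
      using permutes_compose[OF \<pi> \<Pi>I[OF that]] by (simp add: o_def)
    have E_sets: "E \<rho> \<in> sets M" if "\<rho> \<in> ?\<Pi>" for \<rho>
      using \<sigma>set[OF that] by (simp add: E_def)
    have C_sets: "C \<rho> \<in> sets M" if "\<rho> \<in> ?\<Pi>" for \<rho>
      using measurable_sets[OF meas[OF \<rho>\<pi>[OF that]] B]
      by (simp add: C_def vimage_def Int_def conj_commute)
    have disj: "disjoint_family_on E ?\<Pi>"
      by (auto simp: disjoint_family_on_def E_def)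
    have EC_sets: "(\<lambda>\<rho>. E \<rho> \<inter> C \<rho>) ` ?\<Pi> \<subseteq> sets M"
      by (intro image_subsetI sets.Int E_sets C_sets)
    have EC_disj: "disjoint_family_on (\<lambda>\<rho>. E \<rho> \<inter> C \<rho>) ?\<Pi>"
      using disj unfolding disjoint_family_on_def by fast
    have prod: "prob (E \<rho> \<inter> C \<rho>) = prob (E \<rho>) * prob {\<omega> \<in> space M. (\<lambda>i\<in>I. X i \<omega>) \<in> B}"
      if \<rho>: "\<rho> \<in> ?\<Pi>" for \<rho>
    proof -
      let ?U = "\<lambda>\<omega>. \<lambda>i\<in>I. X i \<omega>"
      \<comment> \<open>Moves the permutation from the family into the set, so that
        \<open>C \<rho>\<close> becomes a preimage under the unpermuted family \<open>?U\<close>,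
        the form to which \<open>indep\<close> applies.\<close>
      define B' where "B' = (\<lambda>u. \<lambda>i\<in>I. u (\<rho> (\<pi> i))) -` B \<inter> space ?P"
      have "(\<lambda>u. \<lambda>i\<in>I. u (\<rho> (\<pi> i))) \<in> ?P \<rightarrow>\<^sub>M ?P"
        using permutes_in_image[OF \<rho>\<pi>[OF \<rho>]]
        by (intro measurable_restrict measurable_component_singleton) auto
      then have B': "B' \<in> sets ?P"
        unfolding B'_def using B by (rule measurable_sets)
      have "?U \<in> space M \<rightarrow> space ?P"
        using meas[OF permutes_id] by (auto dest: measurable_space)
      then have C_eq: "C \<rho> = ?U -` B' \<inter> space M"
        using permutes_in_image[OF \<rho>\<pi>[OF \<rho>]]
        by (auto simp: C_def B'_def cong: restrict_cong)
      have E_eq: "E \<rho> = \<sigma> -` {\<rho>} \<inter> space M"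
        by (auto simp: E_def)
      have "prob (E \<rho> \<inter> C \<rho>) = prob (E \<rho>) * prob (C \<rho>)"
        unfolding C_eq E_eq using \<rho> B'
        by (intro indep_setD[OF indep] in_vimage_algebra) auto
      also have "prob (C \<rho>) = prob {\<omega> \<in> space M. (\<lambda>i\<in>I. X i \<omega>) \<in> B}"
        unfolding C_def using exchangeable_permute[OF X \<rho>\<pi>[OF \<rho>] B] .
      finally show ?thesis .
    qed
    have "{\<omega> \<in> space M. (\<lambda>i\<in>I. X (\<sigma> \<omega> (\<pi> i)) \<omega>) \<in> B} = (\<Union>\<rho>\<in>?\<Pi>. E \<rho> \<inter> C \<rho>)"
      using \<sigma>\<Pi> by (auto simp: E_def C_def)
    then have "prob {\<omega> \<in> space M. (\<lambda>i\<in>I. X (\<sigma> \<omega> (\<pi> i)) \<omega>) \<in> B}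
        = (\<Sum>\<rho>\<in>?\<Pi>. prob (E \<rho> \<inter> C \<rho>))"
      using fin EC_sets EC_disj by (simp only: finite_measure_finite_Union)
    also have "\<dots> = (\<Sum>\<rho>\<in>?\<Pi>. prob (E \<rho>)) * prob {\<omega> \<in> space M. (\<lambda>i\<in>I. X i \<omega>) \<in> B}"
      unfolding sum_distrib_right by (intro sum.cong refl prod)
    also have "(\<Sum>\<rho>\<in>?\<Pi>. prob (E \<rho>)) = prob (\<Union>\<rho>\<in>?\<Pi>. E \<rho>)"
      using fin E_sets disj
      by (intro finite_measure_finite_Union[symmetric]) (auto simp del: mem_Collect_eq)
    also have "(\<Union>\<rho>\<in>?\<Pi>. E \<rho>) = space M"
      using \<sigma>\<Pi> by (auto simp: E_def)
    finally show ?thesis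
      unfolding prob_space mult_1_left .
  qed
  show ?thesis
    using X\<sigma> law law[OF permutes_id]
    by (intro exchangeableI \<open>prob_space M\<close>) auto
qed

text \<open>The score function \<open>g\<close> may be learnt from the part of the family indexed by \<open>K\<close>, since a
  transposition inside \<open>J\<close> leaves that part alone.\<close>

lemma exchangeable_rank_bound:
  fixes X :: "nat \<Rightarrow> 'w \<Rightarrow> 'a" and g :: "(nat \<Rightarrow> 'a) \<Rightarrow> 'a \<Rightarrow> real"
  assumes "prob_space M" and X: "exchangeable M S (K \<union> J) X"
    and "finite J" "K \<inter> J = {}" and k: "k \<in> J" and p: "p \<le> card J"
    and g: "case_prod g \<in> borel_measurable (PiM K (\<lambda>_. S) \<Otimes>\<^sub>M S)"
    and A: "A \<in> sets (PiM K (\<lambda>_. S))"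
  defines "D \<equiv> \<lambda>\<omega>. \<lambda>i\<in>K. X i \<omega>"
  shows "{\<omega> \<in> space M. D \<omega> \<in> A
        \<and> card {i \<in> J. g (D \<omega>) (X i \<omega>) < g (D \<omega>) (X k \<omega>)} < p} \<in> sets M" (is ?meas)
    and "real p * measure M {\<omega> \<in> space M. D \<omega> \<in> A}
    \<le> real (card J) * measure M {\<omega> \<in> space M. D \<omega> \<in> A
        \<and> card {i \<in> J. g (D \<omega>) (X i \<omega>) < g (D \<omega>) (X k \<omega>)} < p}" (is ?bound)
proof -
  interpret prob_space M by fact
  let ?P = "PiM (K \<union> J) (\<lambda>_. S)"
  have X': "X i \<in> M \<rightarrow>\<^sub>M S" if "i \<in> K \<union> J" for i
    using X that by (rule exchangeable_measurable)
  have U: "(\<lambda>\<omega>. \<lambda>i\<in>K \<union> J. X i \<omega>) \<in> M \<rightarrow>\<^sub>M ?P"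
    by (intro measurable_restrict X')
  \<comment> \<open>\<open>B j\<close> lives on the product space, where exchangeability compares
    laws; \<open>C j\<close> is the same event on the sample space.\<close>
  define B where "B j = {u \<in> space ?P. restrict u K \<in> A
    \<and> card {i \<in> J. g (restrict u K) (u i) < g (restrict u K) (u j)} < p}" for j
  define C where "C j = {\<omega> \<in> space M. D \<omega> \<in> A
    \<and> card {i \<in> J. g (D \<omega>) (X i \<omega>) < g (D \<omega>) (X j \<omega>)} < p}" for j
  have restr: "(\<lambda>u. restrict u K) \<in> ?P \<rightarrow>\<^sub>M PiM K (\<lambda>_. S)"
    by (intro measurable_restrict_subset) auto
  have gm: "(\<lambda>u. g (restrict u K) (u i)) \<in> borel_measurable ?P" if "i \<in> J" for i
    using measurable_compose[OF measurable_Pair[OF restr measurable_component_singleton] g, of i] that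
    by simp
  have B_sets: "B j \<in> sets ?P" if "j \<in> J" for j
  proof -
    have "(\<lambda>u. card {i \<in> J. g (restrict u K) (u i) < g (restrict u K) (u j)})
        \<in> measurable ?P (count_space UNIV)"
    proof (rule measurable_card)
      fix i
      show "{u \<in> space ?P. i \<in> {i \<in> J. g (restrict u K) (u i) < g (restrict u K) (u j)}} \<in> sets ?P"
        using borel_measurable_less[OF gm gm, of i j] that by (cases "i \<in> J") auto
    qed
    from measurable_sets[OF this, of "{..<p}"]
    have "{u \<in> space ?P. card {i \<in> J. g (restrict u K) (u i) < g (restrict u K) (u j)} < p}
        \<in> sets ?P"
      by (simp add: vimage_def Int_def conj_commute)
    moreover have "{u \<in> space ?P. restrict u K \<in> A} \<in> sets ?P"
      using measurable_sets[OF restr A] by (simp add: vimage_def Int_def conj_commute)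
    ultimately show ?thesis
      unfolding B_def by (intro sets.sets_Collect_conj)
  qed
  have C_eq: "C j = {\<omega> \<in> space M. (\<lambda>i\<in>K \<union> J. X i \<omega>) \<in> B j}" if "j \<in> J" for j
  proof -
    have D_eq: "restrict (\<lambda>i\<in>K \<union> J. X i \<omega>) K = D \<omega>" for \<omega>
      by (auto simp: D_def)
    have "(\<lambda>i\<in>K \<union> J. X i \<omega>) \<in> B j \<longleftrightarrow> D \<omega> \<in> A
        \<and> card {i \<in> J. g (D \<omega>) (X i \<omega>) < g (D \<omega>) (X j \<omega>)} < p" if "\<omega> \<in> space M" for \<omega>
      using measurable_space[OF U that] \<open>j \<in> J\<close>
      unfolding B_def mem_Collect_eq D_eq by (simp cong: conj_cong)
    then show ?thesis
      unfolding C_def by blast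
  qed
  have C_sets: "C j \<in> sets M" if "j \<in> J" for j
    using measurable_sets[OF U B_sets[OF that]] C_eq[OF that]
    by (simp add: vimage_def Int_def conj_commute)
  have C_same: "prob (C j) = prob (C k)" if j: "j \<in> J" for j
  proof -
    \<comment> \<open>Carries the event of \<open>k\<close> to that of \<open>j\<close> without
      touching the data indexed by \<open>K\<close>, and so without changing the learnt score
      function.\<close>
    define \<tau> where "\<tau> = Transposition.transpose j k"
    have \<tau>\<tau>: "\<tau> (\<tau> i) = i" for i
      by (simp add: \<tau>_def)
    have \<tau>J: "\<tau> permutes J"
      unfolding \<tau>_def using j k by (rule permutes_swap_id)
    have \<tau>: "\<tau> permutes (K \<union> J)"
      using \<tau>J by (rule permutes_subset) auto
    have \<tau>K: "\<tau> i = i" if "i \<in> K" for i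
      using \<tau>J that \<open>K \<inter> J = {}\<close> by (auto simp: permutes_def)
    have "(\<lambda>i\<in>K \<union> J. X (\<tau> i) \<omega>) \<in> B k \<longleftrightarrow> \<omega> \<in> C j" if "\<omega> \<in> space M" for \<omega>
    proof -
      have D_eq: "restrict (\<lambda>i\<in>K \<union> J. X (\<tau> i) \<omega>) K = D \<omega>"
        using \<tau>K by (auto simp: D_def)
      have "(\<lambda>i\<in>K \<union> J. X (\<tau> i) \<omega>) \<in> space ?P"
        using measurable_space[OF X' that] permutes_in_image[OF \<tau>] by (simp add: space_PiM)
      \<comment> \<open>The swap only reorders the scores being counted, so the rank of
        \<open>X j\<close> survives it.\<close>
      moreover have "bij_betw \<tau> {i \<in> J. g (D \<omega>) (X (\<tau> i) \<omega>) < g (D \<omega>) (X j \<omega>)}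
          {i \<in> J. g (D \<omega>) (X i \<omega>) < g (D \<omega>) (X j \<omega>)}"
        by (rule bij_betw_byWitness[where f' = \<tau>])
          (auto simp: permutes_in_image[OF \<tau>J] \<tau>\<tau>)
      from bij_betw_same_card[OF this]
      have "card {i \<in> J. g (D \<omega>) (X i \<omega>) < g (D \<omega>) (X j \<omega>)}
          = card {i \<in> J. g (D \<omega>) (X (\<tau> i) \<omega>) < g (D \<omega>) (X j \<omega>)}"
        by simp
      moreover have "\<tau> k = j"
        by (simp add: \<tau>_def)
      ultimately show ?thesis
        using that k unfolding B_def C_def mem_Collect_eq D_eq by (simp cong: conj_cong)
    qed
    then have "C j = {\<omega> \<in> space M. (\<lambda>i\<in>K \<union> J. X (\<tau> i) \<omega>) \<in> B k}"
      by (auto simp: C_def)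
    then show ?thesis
      using exchangeable_permute[OF X \<tau> B_sets[OF k]] C_eq[OF k] by simp
  qed
  have D_meas: "D \<in> M \<rightarrow>\<^sub>M PiM K (\<lambda>_. S)"
    unfolding D_def by (intro measurable_restrict X') auto
  have DA: "{\<omega> \<in> space M. D \<omega> \<in> A} \<in> sets M"
    using measurable_sets[OF D_meas A] by (simp add: vimage_def Int_def conj_commute)
  \<comment> \<open>Pointwise, at least \<open>p\<close> of the events \<open>C j\<close> occur
    whenever \<open>D \<omega> \<in> A\<close>. Taking expectations and using \<open>C_same\<close>
    turns this count into the bound.\<close>
  have count: "real p * indicator {\<omega> \<in> space M. D \<omega> \<in> A} \<omega> \<le> (\<Sum>j\<in>J. indicator (C j) \<omega> :: real)" for \<omega>
  proof (cases "\<omega> \<in> {\<omega> \<in> space M. D \<omega> \<in> A}")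
    case True
    have "(\<Sum>j\<in>J. indicator (C j) \<omega> :: real) = card {j \<in> J. \<omega> \<in> C j}"
      using \<open>finite J\<close> by (simp add: indicator_def sum.If_cases Int_def)
    also have "{j \<in> J. \<omega> \<in> C j}
        = {j \<in> J. card {i \<in> J. g (D \<omega>) (X i \<omega>) < g (D \<omega>) (X j \<omega>)} < p}"
      using True by (auto simp: C_def)
    finally show ?thesis
      using True card_small_rank_ge[OF \<open>finite J\<close> p, of "\<lambda>i. g (D \<omega>) (X i \<omega>)"] by simp
  qed (simp add: sum_nonneg)
  have "real p * prob {\<omega> \<in> space M. D \<omega> \<in> A}
      = (\<integral>\<omega>. real p * indicator {\<omega> \<in> space M. D \<omega> \<in> A} \<omega> \<partial>M)"
    using DA by simp
  also have "\<dots> \<le> (\<integral>\<omega>. (\<Sum>j\<in>J. indicator (C j) \<omega>) \<partial>M)"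
    using DA C_sets count by (intro integral_mono) (auto simp: emeasure_eq_measure)
  also have "\<dots> = (\<Sum>j\<in>J. prob (C j))"
    using C_sets by (subst Bochner_Integration.integral_sum) (auto simp: emeasure_eq_measure)
  also have "\<dots> = real (card J) * prob (C k)"
    using C_same by simp
  finally show ?bound
    by (simp add: C_def)
  show ?meas
    using C_sets[OF k] by (simp add: C_def)
qed

section \<open>Conditional expectation and measurability\<close>

text \<open>The hypothesis is tested on the \<open>F\<close>-measurable set where the conditional
  expectation is below \<open>c\<close>. There the positive deficit has integral at most 0, so the
  set is null.\<close>

lemma (in finite_measure_subalgebra) real_cond_exp_ge_of_set_integral_ge:
  assumes f: "integrable M f"
    and ge: "\<And>A. A \<in> sets F \<Longrightarrow> c * measure M A \<le> (\<integral>x\<in>A. f x \<partial>M)"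
  shows "AE x in M. c \<le> real_cond_exp M F f x"
proof -
  let ?g = "real_cond_exp M F f"
  define A where "A = {x \<in> space M. ?g x < c}"
  have "A = {x \<in> space F. ?g x < c}"
    using subalg by (simp add: A_def subalgebra_def)
  then have AF: "A \<in> sets F"
    by simp
  then have AM: "A \<in> sets M"
    using subalg by (auto simp: subalgebra_def)
  have gi: "integrable M (\<lambda>x. indicator A x * ?g x)"
    using integrable_mult_indicator[OF AM real_cond_exp_int(1)[OF f]] by simp
  have ci: "integrable M (\<lambda>x. indicator A x * c)"
    using AM by (simp add: emeasure_eq_measure)
  have int: "integrable M (\<lambda>x. indicator A x * (c - ?g x))"
    using Bochner_Integration.integrable_diff[OF ci gi] by (simp add: algebra_simps)
  have nonneg: "0 \<le> indicator A x * (c - ?g x)" for x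
    by (auto simp: indicator_def A_def)
  have "(\<integral>x. indicator A x * (c - ?g x) \<partial>M) = c * measure M A - (\<integral>x\<in>A. ?g x \<partial>M)"
    using Bochner_Integration.integral_diff[OF ci gi] AM
    by (simp add: algebra_simps set_lebesgue_integral_def)
  also have "\<dots> \<le> 0"
    using ge[OF AF] real_cond_exp_intA[OF f AF] by simp
  finally have "(\<integral>x. indicator A x * (c - ?g x) \<partial>M) = 0"
    using nonneg by (intro antisym integral_nonneg_AE) auto
  then have "AE x in M. indicator A x * (c - ?g x) = 0"
    using integral_nonneg_eq_0_iff_AE[OF int] nonneg by simp
  then show ?thesis
  proof (rule AE_mp, intro AE_I2 impI)
    fix x assume "x \<in> space M" "indicator A x * (c - ?g x) = 0"
    then show "c \<le> ?g x"
      by (auto simp: A_def indicator_def split: if_splits)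
  qed
qed

text \<open>Homogeneity and the triangle inequality give convexity, and a convex function on a
  finite-dimensional space is continuous. No comparison with the type-class norm is made.\<close>

lemma is_norm_borel_measurable:
  fixes nrm :: "'v::euclidean_space \<Rightarrow> real"
  assumes "is_norm nrm"
  shows "nrm \<in> borel_measurable borel"
proof -
  have "convex_on UNIV nrm"
  proof (rule convex_onI)
    fix t x y assume "0 < (t::real)" "t < 1"
    then show "nrm ((1 - t) *\<^sub>R x + t *\<^sub>R y) \<le> (1 - t) * nrm x + t * nrm y"
      using assms unfolding is_norm_def by (smt (verit, best))
  qed auto
  then show ?thesis
    by (intro borel_measurable_continuous_onI convex_on_continuous) auto
qed

text \<open>Links the score to the tubes; \<open>T \<ge> 1\<close> keeps the maximum over a nonempty
  set.\<close>

lemma score_le_iff: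
  assumes "T \<ge> 1"
  shows "score T nrm r z \<le> c \<longleftrightarrow> (\<forall>t<T. nrm (z t) \<le> c + r t)"
  using assms by (subst score_def, subst Max_le_iff) (auto simp: algebra_simps lessThan_empty_iff)

text \<open>Measurability has to be joint because the radii vary with the dataset \<open>D\<close>
  they are learnt from.\<close>

lemma score_borel_measurable:
  assumes nrm: "nrm \<in> borel_measurable borel"
    and r: "\<And>t. t < T \<Longrightarrow> (\<lambda>D. r D t) \<in> borel_measurable N"
  shows "(\<lambda>(D, z). score T nrm (r D) z) \<in> borel_measurable (N \<Otimes>\<^sub>M trajectory_space T)"
  unfolding score_def split_beta'
proof (intro borel_measurable_Max borel_measurable_diff)
  fix t assume t: "t \<in> {..<T}"
  have "(\<lambda>x. snd x t) \<in> N \<Otimes>\<^sub>M trajectory_space T \<rightarrow>\<^sub>M borel"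
    unfolding trajectory_space_def
    using measurable_compose[OF measurable_snd measurable_component_singleton[OF t]] .
  then show "(\<lambda>x. nrm (snd x t)) \<in> borel_measurable (N \<Otimes>\<^sub>M trajectory_space T)"
    using nrm by (rule measurable_compose)
  show "(\<lambda>x. r (fst x) t) \<in> borel_measurable (N \<Otimes>\<^sub>M trajectory_space T)"
    using t by (intro measurable_compose[OF measurable_fst r]) auto
qed auto

section \<open>Coverage of the OSCP region, marginally and conditionally on
  \<open>D1\<close>\<close>

theorem theorem1:
  fixes M :: "'w measure"
    and nrm :: "real ^ 'd \<Rightarrow> real"
    and \<epsilon> :: real
    and T N n1 n2 :: nat
    and Y Yhat :: "nat \<Rightarrow> 'w \<Rightarrow> (real ^ 'd) trajectory"
    and \<sigma> :: "'w \<Rightarrow> nat \<Rightarrow> nat"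
    and radii :: "(nat \<Rightarrow> (real ^ 'd) trajectory) \<Rightarrow> nat \<Rightarrow> real"
  \<comment> \<open>trajectories \<open>1, \<dots>, N\<close> are the historical ones, \<open>Suc N\<close> is the new one\<close>
  defines "Z \<equiv> \<lambda>i \<omega>. residual T (Y i \<omega>) (Yhat i \<omega>)"
  \<comment> \<open>the split sends the first \<open>n1\<close> entries of a random ordering to \<open>D1\<close>, the rest to \<open>D2\<close>\<close>
  defines "D1 \<equiv> \<lambda>\<omega>. \<lambda>i\<in>{1..n1}. Z (\<sigma> \<omega> i) \<omega>"
  defines "D2 \<equiv> \<lambda>\<omega>. \<lambda>i\<in>{1..n2}. Z (\<sigma> \<omega> (n1 + i)) \<omega>"
  assumes "prob_space M"
    and "0 < \<epsilon>" "\<epsilon> < 1"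
    and "is_norm nrm"
    and "T \<ge> 1"
    and "N = n1 + n2"
    and "\<epsilon> \<ge> 1 / (real n1 + 1)" "\<epsilon> \<ge> 1 / (real n2 + 1)"
    and "exchangeable M (trajectory_space T) {1..Suc N} Z"
    and "\<sigma> \<in> M \<rightarrow>\<^sub>M count_space {\<pi>. \<pi> permutes {1..N}}"
  \<comment> \<open>the split is random, independently of the data\<close>
    and "prob_space.indep_set M
           (sets (vimage_algebra (space M) \<sigma> (count_space {\<pi>. \<pi> permutes {1..N}})))
           (sets (vimage_algebra (space M) (\<lambda>\<omega>. \<lambda>i\<in>{1..Suc N}. Z i \<omega>) (dataset_space T (Suc N))))"
  \<comment> \<open>\<open>radii\<close> solves the mixed-integer program for every possible value of \<open>D1\<close>\<close>
    and "\<And>D. D \<in> space (dataset_space T n1) \<Longrightarrow>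
           milp_optimal_radii T n1 (conformal_rank \<epsilon> n1) (\<lambda>i t. nrm (D i t)) (radii D)"
    and "\<And>t. t < T \<Longrightarrow> (\<lambda>D. radii D t) \<in> borel_measurable (dataset_space T n1)"
  shows "measure M {\<omega> \<in> space M.
           Y (Suc N) \<omega> \<in> oscp_region T nrm \<epsilon> n2 (radii (D1 \<omega>)) (D2 \<omega>) (Yhat (Suc N) \<omega>)} \<ge> 1 - \<epsilon>
     \<and> (AE \<omega> in M.
           real_cond_exp M (vimage_algebra (space M) D1 (dataset_space T n1))
             (indicator {\<omega> \<in> space M. \<forall>t<T.
                Y (Suc N) \<omega> t \<in> oscp_tube T nrm \<epsilon> n2 (radii (D1 \<omega>)) (D2 \<omega>) (Yhat (Suc N) \<omega>) t}) \<omega>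
           \<ge> 1 - \<epsilon>)"
proof -
  interpret prob_space M by fact
  define p where "p = conformal_rank \<epsilon> n2"
  define K where "K = {1..n1}"
  \<comment> \<open>The \<open>n2\<close> positions of \<open>D2\<close> together with the new
    trajectory.\<close>
  define J where "J = {Suc n1..Suc N}"
  define X where "X = (\<lambda>i \<omega>. Z (\<sigma> \<omega> i) \<omega>)"
  define g where "g = (\<lambda>D. score T nrm (radii D))"
  define E where "E = {\<omega> \<in> space M. \<forall>t<T.
    Y (Suc N) \<omega> t \<in> oscp_tube T nrm \<epsilon> n2 (radii (D1 \<omega>)) (D2 \<omega>) (Yhat (Suc N) \<omega>) t}"
  have I_eq: "{1..Suc N} = K \<union> J" and cardJ: "card J = Suc n2"
    using \<open>N = n1 + n2\<close> by (auto simp: K_def J_def)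
  have D1_eq: "D1 = (\<lambda>\<omega>. \<lambda>i\<in>K. X i \<omega>)"
    by (simp add: D1_def K_def X_def)

  have "0 < (1 - \<epsilon>) * (real n2 + 1)"
    using \<open>\<epsilon> < 1\<close> by simp
  then have p_pos: "1 \<le> p"
    unfolding p_def conformal_rank_def by linarith
  have p_ge: "(1 - \<epsilon>) * real (Suc n2) \<le> real p"
    unfolding p_def conformal_rank_def by (simp add: algebra_simps) linarith
  \<comment> \<open>The lower bound on \<open>\<epsilon>\<close>, rearranged; it keeps the rank
    \<open>p\<close> within the list of \<open>n2\<close> scores.\<close>
  have "(1 - \<epsilon>) * (real n2 + 1) \<le> real n2"
    using \<open>\<epsilon> \<ge> 1 / (real n2 + 1)\<close> by (simp add: field_simps)
  then have p_le: "p \<le> n2"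
    unfolding p_def conformal_rank_def by (simp add: nat_le_iff ceiling_le_iff)

  have X: "exchangeable M (trajectory_space T) (K \<union> J) X"
    unfolding X_def I_eq[symmetric]
  proof (rule exchangeable_random_relabelling[where J = "{1..N}"])
    show "{1..N} \<subseteq> {1..Suc N}"
      by auto
  qed (fact | simp)+
  have \<sigma>_new: "\<sigma> \<omega> (Suc N) = Suc N" if "\<omega> \<in> space M" for \<omega>
    using measurable_space[OF \<open>\<sigma> \<in> M \<rightarrow>\<^sub>M _\<close> that] by (auto simp: permutes_def)
  \<comment> \<open>\<open>assms(16)\<close> is the measurability of the radii as functions of the
    dataset.\<close>
  have g: "case_prod g \<in> borel_measurable (dataset_space T n1 \<Otimes>\<^sub>M trajectory_space T)"
    unfolding g_def
    using score_borel_measurable[OF is_norm_borel_measurable[OF \<open>is_norm nrm\<close>],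
        of T radii "dataset_space T n1"] assms(16)
    by blast
  have D1_meas: "D1 \<in> M \<rightarrow>\<^sub>M dataset_space T n1"
    unfolding D1_eq K_def
    by (intro measurable_restrict exchangeable_measurable[OF X]) (auto simp: K_def)

  \<comment> \<open>Membership in all tubes is a single inequality between the new score and the
    \<open>p\<close>-th smallest score of \<open>D2\<close>, which is then read as a rank among
    \<open>J\<close>.\<close>
  have covered_iff: "(\<forall>t<T. Y (Suc N) \<omega> t
        \<in> oscp_tube T nrm \<epsilon> n2 (radii (D1 \<omega>)) (D2 \<omega>) (Yhat (Suc N) \<omega>) t)
      \<longleftrightarrow> card {i \<in> J. g (D1 \<omega>) (X i \<omega>) < g (D1 \<omega>) (X (Suc N) \<omega>)} < p"
    if \<omega>: "\<omega> \<in> space M" for \<omega>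
  proof -
    let ?R = "\<lambda>i. g (D1 \<omega>) (D2 \<omega> i)"
    have new: "X (Suc N) \<omega> t = Y (Suc N) \<omega> t - Yhat (Suc N) \<omega> t" if "t < T" for t
      using that by (simp add: X_def \<sigma>_new[OF \<omega>] Z_def residual_def)
    have "(\<forall>t<T. Y (Suc N) \<omega> t
        \<in> oscp_tube T nrm \<epsilon> n2 (radii (D1 \<omega>)) (D2 \<omega>) (Yhat (Suc N) \<omega>) t)
      \<longleftrightarrow> g (D1 \<omega>) (X (Suc N) \<omega>) \<le> kth_smallest p n2 ?R"
      unfolding g_def score_le_iff[OF \<open>T \<ge> 1\<close>] by (simp add: oscp_tube_def new p_def)
    also have "\<dots> \<longleftrightarrow> card {i \<in> {1..n2}. ?R i < g (D1 \<omega>) (X (Suc N) \<omega>)} < p"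
      using p_pos p_le by (rule le_kth_smallest_iff)
    \<comment> \<open>Entry \<open>i\<close> of \<open>D2\<close> is \<open>X (n1 + i)\<close>. The
      extra index \<open>Suc N\<close> of \<open>J\<close> is never counted, since no score is
      strictly below itself.\<close>
    also have "{i \<in> J. g (D1 \<omega>) (X i \<omega>) < g (D1 \<omega>) (X (Suc N) \<omega>)}
        = (+) n1 ` {i \<in> {1..n2}. ?R i < g (D1 \<omega>) (X (Suc N) \<omega>)}"
    proof safe
      fix i assume i: "i \<in> J" "g (D1 \<omega>) (X i \<omega>) < g (D1 \<omega>) (X (Suc N) \<omega>)"
      then have "i \<noteq> Suc N"
        by auto
      with i have "i - n1 \<in> {1..n2}" "i = n1 + (i - n1)"
        using \<open>N = n1 + n2\<close> by (auto simp: J_def)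
      with i show "i \<in> (+) n1 ` {i \<in> {1..n2}. ?R i < g (D1 \<omega>) (X (Suc N) \<omega>)}"
        by (intro image_eqI[of _ _ "i - n1"]) (auto simp: D2_def X_def)
    qed (use \<open>N = n1 + n2\<close> in \<open>auto simp: J_def D2_def X_def\<close>)
    then have "card {i \<in> {1..n2}. ?R i < g (D1 \<omega>) (X (Suc N) \<omega>)}
        = card {i \<in> J. g (D1 \<omega>) (X i \<omega>) < g (D1 \<omega>) (X (Suc N) \<omega>)}"
      by (simp add: card_image)
    finally show ?thesis .
  qed

  have event: "{\<omega> \<in> space M. D1 \<omega> \<in> A} \<inter> E = {\<omega> \<in> space M. D1 \<omega> \<in> A
      \<and> card {i \<in> J. g (D1 \<omega>) (X i \<omega>) < g (D1 \<omega>) (X (Suc N) \<omega>)} < p}" for A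
    unfolding E_def using covered_iff by blast
  have rank: "{\<omega> \<in> space M. D1 \<omega> \<in> A} \<inter> E \<in> sets M"
    "real p * prob {\<omega> \<in> space M. D1 \<omega> \<in> A}
      \<le> real (Suc n2) * prob ({\<omega> \<in> space M. D1 \<omega> \<in> A} \<inter> E)"
    if A: "A \<in> sets (dataset_space T n1)" for A
    using exchangeable_rank_bound[OF \<open>prob_space M\<close> X, of "Suc N" p g A] A g p_le cardJ
      \<open>N = n1 + n2\<close>
    unfolding event unfolding D1_eq by (auto simp: K_def J_def)
  \<comment> \<open>Taking \<open>A\<close> to be the whole space gives marginal coverage; letting
    \<open>A\<close> vary gives coverage conditional on \<open>D1\<close>.\<close>
  have coverage: "(1 - \<epsilon>) * prob {\<omega> \<in> space M. D1 \<omega> \<in> A}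
      \<le> prob ({\<omega> \<in> space M. D1 \<omega> \<in> A} \<inter> E)"
    if A: "A \<in> sets (dataset_space T n1)" for A
  proof -
    have "real (Suc n2) * ((1 - \<epsilon>) * prob {\<omega> \<in> space M. D1 \<omega> \<in> A})
        \<le> real p * prob {\<omega> \<in> space M. D1 \<omega> \<in> A}"
      unfolding mult.assoc[symmetric] mult.commute[of "real (Suc n2)"]
      by (rule mult_right_mono[OF p_ge measure_nonneg])
    also note rank(2)[OF A]
    finally show ?thesis
      by (simp only: mult_le_cancel_left_pos of_nat_0_less_iff zero_less_Suc)
  qed
  have all: "{\<omega> \<in> space M. D1 \<omega> \<in> space (dataset_space T n1)} = space M"
    using measurable_space[OF D1_meas] by auto
  have E_space: "space M \<inter> E = E"
    unfolding E_def by blast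
  have E_sets: "E \<in> sets M"
    using rank(1)[OF sets.top] unfolding all E_space .

  let ?F = "vimage_algebra (space M) D1 (dataset_space T n1)"
  \<comment> \<open>The events to condition on are exactly those of the form
    \<open>D1 \<omega> \<in> A\<close>, which \<open>coverage\<close> handles.\<close>
  have F_sets: "sets ?F = {D1 -` A \<inter> space M | A. A \<in> sets (dataset_space T n1)}"
    using measurable_space[OF D1_meas] by (intro sets_vimage_algebra2) blast
  have subalg_F: "subalgebra M ?F"
    unfolding subalgebra_def F_sets using measurable_sets[OF D1_meas] by auto
  interpret finite_measure_subalgebra M ?F
    by (intro finite_measure_subalgebra.intro finite_measure_axioms
        finite_measure_subalgebra_axioms.intro subalg_F)
  have "AE \<omega> in M. 1 - \<epsilon> \<le> real_cond_exp M ?F (indicator E) \<omega>"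
  proof (rule real_cond_exp_ge_of_set_integral_ge)
    show "integrable M (indicator E :: _ \<Rightarrow> real)"
      using E_sets by (simp add: emeasure_eq_measure)
    fix B assume "B \<in> sets ?F"
    then obtain A where A: "A \<in> sets (dataset_space T n1)"
      and B: "B = {\<omega> \<in> space M. D1 \<omega> \<in> A}"
      unfolding F_sets by blast
    have "(\<integral>\<omega>\<in>B. indicator E \<omega> \<partial>M) = (\<integral>\<omega>. indicator (B \<inter> E) \<omega> \<partial>M)"
      by (auto simp: set_lebesgue_integral_def indicator_def
          intro!: Bochner_Integration.integral_cong)
    also have "\<dots> = prob (B \<inter> E)"
      using rank(1)[OF A] by (simp add: B)
    finally show "(1 - \<epsilon>) * prob B \<le> (\<integral>\<omega>\<in>B. indicator E \<omega> \<partial>M)"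
      using coverage[OF A] by (simp add: B)
  qed
  moreover have "1 - \<epsilon> \<le> prob E"
    using coverage[OF sets.top] unfolding all E_space prob_space by simp
  moreover have "{\<omega> \<in> space M.
      Y (Suc N) \<omega> \<in> oscp_region T nrm \<epsilon> n2 (radii (D1 \<omega>)) (D2 \<omega>) (Yhat (Suc N) \<omega>)} = E"
    by (simp add: E_def oscp_region_def Pi_iff Ball_def)
  ultimately show ?thesis
    unfolding E_def[symmetric] by simp
qed

end
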